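(* Let $G$ be a medial quasigroup, and let $(G,Par)$ denote the set of all quadruples $(a,b,c,d)\in G^4$ for which $Par(a,b,c,d)$ holds, with the componentwise operation $(a_1,b_1,c_1,d_1)\,@\,(a_2,b_2,c_2,d_2)=(a_1a_2,b_1b_2,c_1c_2,d_1d_2)$. Then $(G,Par)$ under $@$ is also a medial quasigroup.
   Context: A quasigroup is a set $G$ with a binary operation (written as juxtaposition) such that for any $a,b\in G$ the equations $ax=b$ and $ya=b$ have unique solutions $x,y\in G$. A quasigroup is medial if $(ab)(cd)=(ac)(bd)$ for all of its elements $a,b,c,d$. For $a,b,c,d\in G$, we say that $a,b,c,d$ form a parallelogram, written $Par(a,b,c,d)$, if there are $p,q\in G$ such that $pa=qb$ and $pd=qc$. The assertion includes that the set of parallelogram quadruples is closed under $@$. *)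

theory Defs
  imports Main
begin

(* The carrier is an arbitrary set, possibly empty: nonemptiness is not part of the notion. *)
locale quasigroup =
  fixes G :: "'a set" and mult :: "'a \<Rightarrow> 'a \<Rightarrow> 'a" (infixl \<open>\<cdot>\<close> 70)
  assumes closed: "\<lbrakk>a \<in> G; b \<in> G\<rbrakk> \<Longrightarrow> a \<cdot> b \<in> G"
    and ex1_right_factor: "\<lbrakk>a \<in> G; b \<in> G\<rbrakk> \<Longrightarrow> \<exists>!x. x \<in> G \<and> a \<cdot> x = b"
    and ex1_left_factor: "\<lbrakk>a \<in> G; b \<in> G\<rbrakk> \<Longrightarrow> \<exists>!y. y \<in> G \<and> y \<cdot> a = b"

locale medial_quasigroup = quasigroup +
  assumes medial: "\<lbrakk>a \<in> G; b \<in> G; c \<in> G; d \<in> G\<rbrakk> \<Longrightarrow> (a \<cdot> b) \<cdot> (c \<cdot> d) = (a \<cdot> c) \<cdot> (b \<cdot> d)"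

definition Par :: "'a set \<Rightarrow> ('a \<Rightarrow> 'a \<Rightarrow> 'a) \<Rightarrow> 'a \<Rightarrow> 'a \<Rightarrow> 'a \<Rightarrow> 'a \<Rightarrow> bool" where
  "Par G mult a b c d \<longleftrightarrow>
     (\<exists>p\<in>G. \<exists>q\<in>G. mult p a = mult q b \<and> mult p d = mult q c)"

definition Par_quadruples :: "'a set \<Rightarrow> ('a \<Rightarrow> 'a \<Rightarrow> 'a) \<Rightarrow> ('a \<times> 'a \<times> 'a \<times> 'a) set" where
  "Par_quadruples G mult = {(a, b, c, d) \<in> G \<times> G \<times> G \<times> G. Par G mult a b c d}"

fun quad_mult :: "('a \<Rightarrow> 'a \<Rightarrow> 'a) \<Rightarrow>
    'a \<times> 'a \<times> 'a \<times> 'a \<Rightarrow> 'a \<times> 'a \<times> 'a \<times> 'a \<Rightarrow> 'a \<times> 'a \<times> 'a \<times> 'a" where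
  "quad_mult mult (a1, b1, c1, d1) (a2, b2, c2, d2) =
     (mult a1 a2, mult b1 b2, mult c1 c2, mult d1 d2)"

end

(* Parallelograms multiply because medial products of their witnesses (p, q) are again witnesses.
   Conversely, if a parallelogram with witnesses (p, q) times a quadruple X is a parallelogram with
   witnesses (p', q'), solve p s = p' and q t = q'; mediality and cancellation show that (s, t) are
   witnesses for X. Hence the componentwise solutions of equations between parallelograms are
   parallelograms. *)
theory Submission
  imports Defs
begin

context quasigroup
begin

lemma left_cancel:
  assumes "a \<in> G" "x \<in> G" "y \<in> G" "a \<cdot> x = a \<cdot> y"
  shows "x = y"
  using assms ex1_right_factor[of a "a \<cdot> y"] closed by blast

lemma right_cancel:
  assumes "a \<in> G" "x \<in> G" "y \<in> G" "x \<cdot> a = y \<cdot> a"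
  shows "x = y"
  using assms ex1_left_factor[of a "y \<cdot> a"] closed by blast

lemma right_factorE:
  assumes "a \<in> G" "b \<in> G"
  obtains x where "x \<in> G" "a \<cdot> x = b"
  using ex1_right_factor[OF assms] by blast

lemma left_factorE:
  assumes "a \<in> G" "b \<in> G"
  obtains y where "y \<in> G" "y \<cdot> a = b"
  using ex1_left_factor[OF assms] by blast

end

context medial_quasigroup
begin

lemma Par_mult:
  assumes G: "a \<in> G" "b \<in> G" "c \<in> G" "d \<in> G" "x \<in> G" "y \<in> G" "z \<in> G" "w \<in> G"
    and "Par G (\<cdot>) a b c d" "Par G (\<cdot>) x y z w"
  shows "Par G (\<cdot>) (a \<cdot> x) (b \<cdot> y) (c \<cdot> z) (d \<cdot> w)"
proof -
  obtain p q where pq: "p \<in> G" "q \<in> G" "p \<cdot> a = q \<cdot> b" "p \<cdot> d = q \<cdot> c"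
    using assms(9) by (auto simp: Par_def)
  obtain s t where st: "s \<in> G" "t \<in> G" "s \<cdot> x = t \<cdot> y" "s \<cdot> w = t \<cdot> z"
    using assms(10) by (auto simp: Par_def)
  \<comment> \<open>Mediality regroups the left-hand side of the first equation as
    \<open>(p \<cdot> a) \<cdot> (s \<cdot> x)\<close>. Replacing both factors by
    \<open>q \<cdot> b\<close> and \<open>t \<cdot> y\<close> and regrouping back gives the
    right-hand side. The second equation is the same with \<open>d\<close>, \<open>w\<close>,
    \<open>c\<close>, \<open>z\<close>.\<close>
  have "(p \<cdot> s) \<cdot> (a \<cdot> x) = (q \<cdot> t) \<cdot> (b \<cdot> y)" "(p \<cdot> s) \<cdot> (d \<cdot> w) = (q \<cdot> t) \<cdot> (c \<cdot> z)"
    using medial[of p s a x] medial[of q t b y] medial[of p s d w] medial[of q t c z] G pq st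
    by simp_all
  then show ?thesis
    unfolding Par_def using closed[of p s] closed[of q t] pq st by blast
qed

lemma Par_right_factor:
  assumes G: "a \<in> G" "b \<in> G" "c \<in> G" "d \<in> G" "x \<in> G" "y \<in> G" "z \<in> G" "w \<in> G"
    and "Par G (\<cdot>) a b c d" "Par G (\<cdot>) (a \<cdot> x) (b \<cdot> y) (c \<cdot> z) (d \<cdot> w)"
  shows "Par G (\<cdot>) x y z w"
proof -
  obtain p q where pq: "p \<in> G" "q \<in> G" "p \<cdot> a = q \<cdot> b" "p \<cdot> d = q \<cdot> c"
    using assms(9) by (auto simp: Par_def)
  obtain p' q' where pq': "p' \<in> G" "q' \<in> G"
    "p' \<cdot> (a \<cdot> x) = q' \<cdot> (b \<cdot> y)" "p' \<cdot> (d \<cdot> w) = q' \<cdot> (c \<cdot> z)"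
    using assms(10) by (auto simp: Par_def)
  \<comment> \<open>The new witnesses are divided by the old ones on the side that lets mediality
    pair \<open>p\<close> with \<open>a\<close>: \<open>p' \<cdot> (a \<cdot> x) = (p \<cdot> a)
    \<cdot> (s \<cdot> x)\<close>, and likewise \<open>q\<close> with \<open>b\<close>.\<close>
  obtain s where s: "s \<in> G" "p \<cdot> s = p'" using right_factorE pq pq' by blast
  obtain t where t: "t \<in> G" "q \<cdot> t = q'" using right_factorE pq pq' by blast
  \<comment> \<open>Since \<open>p \<cdot> a = q \<cdot> b\<close>, both sides acquire the same left
    factor, which can then be cancelled.\<close>
  have "(q \<cdot> b) \<cdot> (s \<cdot> x) = (q \<cdot> b) \<cdot> (t \<cdot> y)"
    using medial[of p s a x] medial[of q t b y] G pq pq' s t by simp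
  moreover have "(q \<cdot> c) \<cdot> (s \<cdot> w) = (q \<cdot> c) \<cdot> (t \<cdot> z)"
    using medial[of p s d w] medial[of q t c z] G pq pq' s t by simp
  ultimately have "s \<cdot> x = t \<cdot> y" "s \<cdot> w = t \<cdot> z"
    using left_cancel[of "q \<cdot> b" "s \<cdot> x" "t \<cdot> y"] left_cancel[of "q \<cdot> c" "s \<cdot> w" "t \<cdot> z"]
      closed G pq s t by simp_all
  then show ?thesis
    using s t unfolding Par_def by blast
qed

text \<open>This is not the formal dual of \<open>Par_right_factor\<close> under reversal of the
  product, because the witnesses in \<open>Par\<close> always multiply from the left. Only the
  division and the cancellation change sides.\<close>

lemma Par_left_factor:
  assumes G: "a \<in> G" "b \<in> G" "c \<in> G" "d \<in> G" "x \<in> G" "y \<in> G" "z \<in> G" "w \<in> G"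
    and "Par G (\<cdot>) a b c d" "Par G (\<cdot>) (x \<cdot> a) (y \<cdot> b) (z \<cdot> c) (w \<cdot> d)"
  shows "Par G (\<cdot>) x y z w"
proof -
  obtain p q where pq: "p \<in> G" "q \<in> G" "p \<cdot> a = q \<cdot> b" "p \<cdot> d = q \<cdot> c"
    using assms(9) by (auto simp: Par_def)
  obtain p' q' where pq': "p' \<in> G" "q' \<in> G"
    "p' \<cdot> (x \<cdot> a) = q' \<cdot> (y \<cdot> b)" "p' \<cdot> (w \<cdot> d) = q' \<cdot> (z \<cdot> c)"
    using assms(10) by (auto simp: Par_def)
  obtain s where s: "s \<in> G" "s \<cdot> p = p'" using left_factorE pq pq' by blast
  obtain t where t: "t \<in> G" "t \<cdot> q = q'" using left_factorE pq pq' by blast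
  \<comment> \<open>With \<open>s \<cdot> p = p'\<close>, mediality gives \<open>p' \<cdot> (x
    \<cdot> a) = (s \<cdot> x) \<cdot> (p \<cdot> a)\<close>, so the common factor
    \<open>q \<cdot> b\<close> now stands on the right.\<close>
  have "(s \<cdot> x) \<cdot> (q \<cdot> b) = (t \<cdot> y) \<cdot> (q \<cdot> b)"
    using medial[of s p x a] medial[of t q y b] G pq pq' s t by simp
  moreover have "(s \<cdot> w) \<cdot> (q \<cdot> c) = (t \<cdot> z) \<cdot> (q \<cdot> c)"
    using medial[of s p w d] medial[of t q z c] G pq pq' s t by simp
  ultimately have "s \<cdot> x = t \<cdot> y" "s \<cdot> w = t \<cdot> z"
    using right_cancel[of "q \<cdot> b" "s \<cdot> x" "t \<cdot> y"] right_cancel[of "q \<cdot> c" "s \<cdot> w" "t \<cdot> z"]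
      closed G pq s t by simp_all
  then show ?thesis
    using s t unfolding Par_def by blast
qed

lemma Par_quadruples_ex1_right_factor:
  assumes "A \<in> Par_quadruples G (\<cdot>)" "B \<in> Par_quadruples G (\<cdot>)"
  shows "\<exists>!X. X \<in> Par_quadruples G (\<cdot>) \<and> quad_mult (\<cdot>) A X = B"
proof -
  obtain a b c d where A: "A = (a, b, c, d)" "a \<in> G" "b \<in> G" "c \<in> G" "d \<in> G"
      "Par G (\<cdot>) a b c d"
    using assms(1) by (auto simp: Par_quadruples_def)
  obtain a' b' c' d' where B: "B = (a', b', c', d')" "a' \<in> G" "b' \<in> G" "c' \<in> G" "d' \<in> G"
      "Par G (\<cdot>) a' b' c' d'"
    using assms(2) by (auto simp: Par_quadruples_def)
  obtain x where x: "x \<in> G" "a \<cdot> x = a'" using right_factorE A B by blast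
  obtain y where y: "y \<in> G" "b \<cdot> y = b'" using right_factorE A B by blast
  obtain z where z: "z \<in> G" "c \<cdot> z = c'" using right_factorE A B by blast
  obtain w where w: "w \<in> G" "d \<cdot> w = d'" using right_factorE A B by blast
  \<comment> \<open>The componentwise solution multiplies the parallelogram \<open>A\<close> into
    the parallelogram \<open>B\<close>, hence is one itself.\<close>
  have "Par G (\<cdot>) x y z w"
    using Par_right_factor[of a b c d x y z w] A B x y z w by simp
  \<comment> \<open>Uniqueness is cancellation in each of the four components.\<close>
  then show ?thesis
    using A B x y z w left_cancel
    by (intro ex1I[of _ "(x, y, z, w)"]) (auto simp: Par_quadruples_def)
qed

lemma Par_quadruples_ex1_left_factor:
  assumes "A \<in> Par_quadruples G (\<cdot>)" "B \<in> Par_quadruples G (\<cdot>)"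
  shows "\<exists>!X. X \<in> Par_quadruples G (\<cdot>) \<and> quad_mult (\<cdot>) X A = B"
proof -
  obtain a b c d where A: "A = (a, b, c, d)" "a \<in> G" "b \<in> G" "c \<in> G" "d \<in> G"
      "Par G (\<cdot>) a b c d"
    using assms(1) by (auto simp: Par_quadruples_def)
  obtain a' b' c' d' where B: "B = (a', b', c', d')" "a' \<in> G" "b' \<in> G" "c' \<in> G" "d' \<in> G"
      "Par G (\<cdot>) a' b' c' d'"
    using assms(2) by (auto simp: Par_quadruples_def)
  obtain x where x: "x \<in> G" "x \<cdot> a = a'" using left_factorE A B by blast
  obtain y where y: "y \<in> G" "y \<cdot> b = b'" using left_factorE A B by blast
  obtain z where z: "z \<in> G" "z \<cdot> c = c'" using left_factorE A B by blast
  obtain w where w: "w \<in> G" "w \<cdot> d = d'" using left_factorE A B by blast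
  \<comment> \<open>Here \<open>A\<close> is the right factor of \<open>B\<close>, so the
    parallelogram property passes to the left factor.\<close>
  have "Par G (\<cdot>) x y z w"
    using Par_left_factor[of a b c d x y z w] A B x y z w by simp
  then show ?thesis
    using A B x y z w right_cancel
    by (intro ex1I[of _ "(x, y, z, w)"]) (auto simp: Par_quadruples_def)
qed

end

theorem theorem8:
  fixes G :: "'a set" and mult :: "'a \<Rightarrow> 'a \<Rightarrow> 'a"
  assumes "medial_quasigroup G mult"
  shows "medial_quasigroup (Par_quadruples G mult) (quad_mult mult)"
proof -
  interpret medial_quasigroup G mult by (fact assms)
  show ?thesis
  \<comment> \<open>Closure rests on \<open>Par_mult\<close>; mediality is an identity and is
    inherited componentwise; the two solvability axioms are the lemmas just proved.\<close>
  proof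
    fix A B assume "A \<in> Par_quadruples G mult" "B \<in> Par_quadruples G mult"
    then show "quad_mult mult A B \<in> Par_quadruples G mult"
      by (auto simp: Par_quadruples_def closed Par_mult)
  next
    fix A B C D
    assume "A \<in> Par_quadruples G mult" "B \<in> Par_quadruples G mult"
      "C \<in> Par_quadruples G mult" "D \<in> Par_quadruples G mult"
    then show "quad_mult mult (quad_mult mult A B) (quad_mult mult C D) =
        quad_mult mult (quad_mult mult A C) (quad_mult mult B D)"
      by (auto simp: Par_quadruples_def medial)
  qed (fact Par_quadruples_ex1_right_factor Par_quadruples_ex1_left_factor)+
qed

end
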